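(* Let $u:\mathbb{R}^2\to\mathbb{C}$ be the piecewise linear function $$u(x)=\sum_{j=1}^J(\alpha_j^Tx+\beta_j)\,1_{\Omega_j}(x),\qquad \alpha_j\in\mathbb{C}^2,\ \beta_j\in\mathbb{C},$$ where $\Omega_1,\dots,\Omega_J\subset[-1/2,1/2)^2$ are pairwise disjoint domains and the representation uses the smallest possible number of characteristic functions. Let $p$ be a vector field associated with $u$ as specified in the context, and let $v=\mathcal{F}(u)|_{O}$ and $q=\mathcal{F}(p)|_{O}$ be the Fourier samples on $O$. Let $K\subset O$ be a rectangular $K_1\times K_2$ grid, $M_1=|O:K|$, $M_2=|K|$, and let $\mathcal{H}(\mathcal{D}v-q)\in\mathbb{C}^{2M_1\times M_2}$ and $\mathcal{H}(\mathcal{E}q)\in\mathbb{C}^{4M_1\times M_2}$ be the multi-fold Hankel matrices with filter support $K$. Assume $$\operatorname{rank}\mathcal{H}(\mathcal{D}v-q)=r_1<\min\{2M_1,M_2\},\qquad \operatorname{rank}\mathcal{H}(\mathcal{E}q)=r_2<\min\{4M_1,M_2\}.$$ Consider full singular value decompositions $\mathcal{H}(\mathcal{D}v-q)=X_1\Sigma_1Y_1^*$ and $\mathcal{H}(\mathcal{E}q)=X_2\Sigma_2Y_2^*$ with singular values in nonincreasing order, and for $l=1,\dots,M_2$ let $a_{1l}=M_2^{-1/2}Y_1^{(:,l)}$ and $a_{2l}=M_2^{-1/2}Y_2^{(:,l)}$, where the $l$-th column is viewed as a $K_1\times K_2$ filter supported on $K$. Let $\mathcal{W}_i$ ($i=1,2$)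 be the analysis operator generated by the filters $a_{i1},\dots,a_{iM_2}$. Then $$\mathcal{W}_1^*\mathcal{W}_1(\mathcal{D}v-q)=\sum_{l=1}^{M_2}\mathcal{S}_{\overline{a}_{1l}}\big(\mathcal{S}_{a_{1l}(-\cdot)}(\mathcal{D}v-q)\big)=\mathcal{D}v-q,$$ $$\mathcal{W}_2^*\mathcal{W}_2(\mathcal{E}q)=\sum_{l=1}^{M_2}\mathcal{S}_{\overline{a}_{2l}}\big(\mathcal{S}_{a_{2l}(-\cdot)}(\mathcal{E}q)\big)=\mathcal{E}q,$$ and for every $k\in O:K$, $$\big(\mathcal{S}_{a_{1l}(-\cdot)}(\mathcal{D}v-q)\big)(k)=0,\quad l=r_1+1,\dots,M_2,$$ $$\big(\mathcal{S}_{a_{2l}(-\cdot)}(\mathcal{E}q)\big)(k)=0,\quad l=r_2+1,\dots,M_2,$$ where the discrete convolutions act on each component of $\mathcal{D}v-q$ and $\mathcal{E}q$. Consequently, the right singular vectors of each of these Hankel matrices construct a tight frame ($\mathcal{W}_i^*\mathcal{W}_i=I$) under which $\mathcal{D}v-q$ (respectively $\mathcal{E}q$) is sparsely represented, in the sense of the vanishing coefficients above.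
   Context: Fourier transform: $\mathcal{F}(f)(\xi)=\int_{\mathbb{R}^2}f(x)e^{-2\pi i\xi\cdot x}\,dx$, extended to tempered distributions, applied componentwise. Grid: $O=\{-\lfloor N/2\rfloor,\dots,\lfloor (N-1)/2\rfloor\}^2$, $N\in\mathbb{N}$. For rectangular grids $A,B\subset\mathbb{Z}^2$, $A:B=\{k\in A:k+m\in A\text{ for all }m\in B\}$. The vector field $p$: with $\Gamma=\bigcup_j\partial\Omega_j$, it is assumed that $\Gamma\subseteq\{\varphi=0\}$ for a trigonometric polynomial $\varphi(x)=\sum_{k\in\Lambda}a(k)e^{-2\pi ik\cdot x}$ with $\Lambda\subset\mathbb{Z}^2$ finite, rectangular and symmetric about $0$, and $p=(p_1,p_2):\mathbb{R}^2\to\mathbb{C}^2$ is an integrable compactly supported vector field with $\sum_{k\in\Lambda}\mathcal{F}(\nabla u-p)(\xi+k)a(k)=0$ and $\sum_{k\in\Lambda}\mathcal{F}(\nabla_sp)(\xi+k)a(k)=0$ for all $\xi\in\mathbb{R}^2$, where derivatives are distributional and $\nabla_sp=\frac12(\nabla p+\nabla p^T)$. Operators: for $v:O\to\mathbb{C}$, $q=(q_1,q_2):O\to\mathbb{C}^2$ and $k=(k_1,k_2)\in O$, $$(\mathcal{D}v)(k)=(2\pi ik_1v(k),\,2\pi ik_2v(k)),$$ $$(\mathcal{E}q)(k)=\begin{pmatrix}2\pi ik_1q_1(k)&\pi i(k_2q_1(k)+k_1q_2(k))\\ \pi i(k_2q_1(k)+k_1q_2(k))&2\pi ik_2q_2(k)\end{pmatrix}.$$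 Hankel matrices: for $w:O\to\mathbb{C}$, $\mathcal{H}w$ is the $M_1\times M_2$ matrix with entries $(\mathcal{H}w)(k,m)=w(k+m)$, $k\in O:K$, $m\in K$; for a tuple of functions on $O$ (2 components for $\mathcal{D}v-q$, 4 for $\mathcal{E}q$), $\mathcal{H}$ stacks the Hankel matrices of the components vertically. Full SVD: $Y_i$ is an $M_2\times M_2$ unitary matrix, $X_i$ is unitary, and $\Sigma_i$ is rectangular diagonal; the entries of columns of $Y_i$ are indexed by $m\in K$. Convolution and frames: $\mathcal{S}_a w=a*w$ is discrete convolution under the periodic boundary condition, $(\mathcal{S}_aw)(k)=\sum_{m\in\mathbb{Z}^2}a(k-m)w(m)$ with $w$ extended $N$-periodically in each coordinate; $a(-\cdot)$ is the filter $k\mapsto a(-k)$, $\overline{a}$ the complex conjugate filter. For filters $a_1,\dots,a_{M_2}$ supported on $K$, the analysis operator is $\mathcal{W}w=(\mathcal{S}_{a_1(-\cdot)}w,\dots,\mathcal{S}_{a_{M_2}(-\cdot)}w)$, and its adjoint is $\mathcal{W}^*(c_1,\dots,c_{M_2})=\sum_{l}\mathcal{S}_{\overline{a}_l}c_l$; both act componentwise on tuples. The filters form a tight frame if $\mathcal{W}^*\mathcal{W}=I$. *)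

theory Defs
  imports
    "HOL-Analysis.Analysis"
    "Jordan_Normal_Form.Schur_Decomposition"
    "Jordan_Normal_Form.DL_Rank"
begin

text \<open>
  Both HOL-Analysis and Jordan_Normal_Form are used: \<open>real ^ 2\<close> and \<open>complex ^ 2\<close> for points and
  vector fields (components \<open>x $ i\<close>), and \<open>complex mat\<close> (entries \<open>A $$ (i, j)\<close>, indices from \<open>0\<close>)
  for the Hankel matrices, whose dimensions depend on the data.
\<close>

no_notation vec_index (infixl \<open>$\<close> 100)
hide_const (open) Matrix.vec

definition fourier :: "(real ^ 2 \<Rightarrow> complex) \<Rightarrow> real ^ 2 \<Rightarrow> complex" where
  "fourier f \<xi> = (\<integral>x. f x * exp (- 2 * pi * \<i> * complex_of_real (\<xi> \<bullet> x)) \<partial>lborel)"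

definition partial_deriv :: "2 \<Rightarrow> (real ^ 2 \<Rightarrow> complex) \<Rightarrow> real ^ 2 \<Rightarrow> complex" where
  "partial_deriv i f x = frechet_derivative f (at x) (axis i 1)"

text \<open>The list of directions plays the role of a multi-index.\<close>

definition iter_deriv :: "2 list \<Rightarrow> (real ^ 2 \<Rightarrow> complex) \<Rightarrow> real ^ 2 \<Rightarrow> complex" where
  "iter_deriv ds f = foldr partial_deriv ds f"

definition schwartz :: "(real ^ 2 \<Rightarrow> complex) \<Rightarrow> bool" where
  "schwartz f \<longleftrightarrow>
     (\<forall>ds x. iter_deriv ds f differentiable (at x)) \<and>
     (\<forall>ds n. \<exists>C. \<forall>x. norm x ^ n * norm (iter_deriv ds f x) \<le> C)"

text \<open>
  A tempered distribution is given by its action on Schwartz functions; its values at other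
  arguments play no role. The functionals formed below are all derived from integrable functions
  by differentiation and linear combination, hence are tempered.
\<close>

type_synonym distr = "(real ^ 2 \<Rightarrow> complex) \<Rightarrow> complex"

definition distr_of :: "(real ^ 2 \<Rightarrow> complex) \<Rightarrow> distr" where
  "distr_of f \<phi> = (\<integral>x. f x * \<phi> x \<partial>lborel)"

definition distr_deriv :: "2 \<Rightarrow> distr \<Rightarrow> distr" where
  "distr_deriv i T \<phi> = - T (partial_deriv i \<phi>)"

definition distr_fourier :: "distr \<Rightarrow> distr" where
  "distr_fourier T \<phi> = T (fourier \<phi>)"

text \<open>
  The Fourier transform of a compactly supported distribution is a continuous function of at most
  polynomial growth (Paley-Wiener-Schwartz), so it has values at points. \<open>fourier_at T\<close> is this
  function, which is unique as a continuous function.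
\<close>

definition fourier_at :: "distr \<Rightarrow> real ^ 2 \<Rightarrow> complex" where
  "fourier_at T = (THE g. continuous_on UNIV g \<and>
     (\<forall>\<phi>. schwartz \<phi> \<longrightarrow> integrable lborel (\<lambda>x. g x * \<phi> x) \<and> distr_fourier T \<phi> = distr_of g \<phi>))"

definition grad_minus :: "(real ^ 2 \<Rightarrow> complex) \<Rightarrow> (real ^ 2 \<Rightarrow> complex ^ 2) \<Rightarrow> 2 \<Rightarrow> distr" where
  "grad_minus u p i \<phi> = distr_deriv i (distr_of u) \<phi> - distr_of (\<lambda>x. p x $ i) \<phi>"

definition sym_grad :: "(real ^ 2 \<Rightarrow> complex ^ 2) \<Rightarrow> 2 \<Rightarrow> 2 \<Rightarrow> distr" where
  "sym_grad p i j \<phi> =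
     1 / 2 * (distr_deriv i (distr_of (\<lambda>x. p x $ j)) \<phi> + distr_deriv j (distr_of (\<lambda>x. p x $ i)) \<phi>)"

text \<open>Domains are nonempty, open and connected; the representation is an identity at every point.\<close>

definition pw_linear_rep ::
  "(real ^ 2 \<Rightarrow> complex) \<Rightarrow> nat \<Rightarrow> (nat \<Rightarrow> (real ^ 2) set) \<Rightarrow> (nat \<Rightarrow> complex ^ 2) \<Rightarrow> (nat \<Rightarrow> complex) \<Rightarrow> bool"
where
  "pw_linear_rep u J \<Omega> \<alpha> \<beta> \<longleftrightarrow>
     (\<forall>j\<in>{1..J}. open (\<Omega> j) \<and> connected (\<Omega> j) \<and> \<Omega> j \<noteq> {} \<and>
        \<Omega> j \<subseteq> {x. \<forall>i. - 1 / 2 \<le> x $ i \<and> x $ i < 1 / 2}) \<and>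
     disjoint_family_on \<Omega> {1..J} \<and>
     (\<forall>x. u x = (\<Sum>j = 1..J.
        ((\<Sum>i\<in>UNIV. \<alpha> j $ i * complex_of_real (x $ i)) + \<beta> j) * indicator (\<Omega> j) x))"

definition minimal_pw_linear_rep ::
  "(real ^ 2 \<Rightarrow> complex) \<Rightarrow> nat \<Rightarrow> (nat \<Rightarrow> (real ^ 2) set) \<Rightarrow> (nat \<Rightarrow> complex ^ 2) \<Rightarrow> (nat \<Rightarrow> complex) \<Rightarrow> bool"
where
  "minimal_pw_linear_rep u J \<Omega> \<alpha> \<beta> \<longleftrightarrow>
     pw_linear_rep u J \<Omega> \<alpha> \<beta> \<and> (\<forall>J' \<Omega>' \<alpha>' \<beta>'. pw_linear_rep u J' \<Omega>' \<alpha>' \<beta>' \<longrightarrow> J \<le> J')"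

definition pt :: "int \<times> int \<Rightarrow> real ^ 2" where
  "pt k = vector [of_int (fst k), of_int (snd k)]"

definition rectangular :: "(int \<times> int) set \<Rightarrow> bool" where
  "rectangular A \<longleftrightarrow> (\<exists>l1 h1 l2 h2. l1 \<le> h1 \<and> l2 \<le> h2 \<and> A = {l1..h1} \<times> {l2..h2})"

definition trig_poly :: "(int \<times> int) set \<Rightarrow> (int \<times> int \<Rightarrow> complex) \<Rightarrow> real ^ 2 \<Rightarrow> complex" where
  "trig_poly \<Lambda> a x = (\<Sum>k\<in>\<Lambda>. a k * exp (- 2 * pi * \<i> * complex_of_real (pt k \<bullet> x)))"

definition associated_field ::
  "(real ^ 2 \<Rightarrow> complex) \<Rightarrow> (real ^ 2) set \<Rightarrow> (int \<times> int) set \<Rightarrow> (int \<times> int \<Rightarrow> complex) \<Rightarrow>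
   (real ^ 2 \<Rightarrow> complex ^ 2) \<Rightarrow> bool"
where
  "associated_field u \<Gamma> \<Lambda> a p \<longleftrightarrow>
     rectangular \<Lambda> \<and> (\<forall>k\<in>\<Lambda>. - k \<in> \<Lambda>) \<and>
     \<Gamma> \<subseteq> {x. trig_poly \<Lambda> a x = 0} \<and>
     integrable lborel p \<and> compact (closure {x. p x \<noteq> 0}) \<and>
     (\<forall>\<xi> i. (\<Sum>k\<in>\<Lambda>. fourier_at (grad_minus u p i) (\<xi> + pt k) * a k) = 0) \<and>
     (\<forall>\<xi> i j. (\<Sum>k\<in>\<Lambda>. fourier_at (sym_grad p i j) (\<xi> + pt k) * a k) = 0)"

text \<open>
  A function on the grid \<open>O\<close> is represented by a function on \<open>int \<times> int\<close> of which only the values on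
  \<open>O\<close> are used.
\<close>

definition grid :: "nat \<Rightarrow> (int \<times> int) set" where
  "grid N = {- \<lfloor>real N / 2\<rfloor>..\<lfloor>(real N - 1) / 2\<rfloor>} \<times> {- \<lfloor>real N / 2\<rfloor>..\<lfloor>(real N - 1) / 2\<rfloor>}"

definition grid_colon :: "(int \<times> int) set \<Rightarrow> (int \<times> int) set \<Rightarrow> (int \<times> int) set" where
  "grid_colon A B = {k \<in> A. \<forall>m\<in>B. k + m \<in> A}"

definition opD :: "(int \<times> int \<Rightarrow> complex) \<Rightarrow> int \<times> int \<Rightarrow> complex ^ 2" where
  "opD v k = vector [2 * pi * \<i> * of_int (fst k) * v k, 2 * pi * \<i> * of_int (snd k) * v k]"

definition opE :: "(int \<times> int \<Rightarrow> complex ^ 2) \<Rightarrow> int \<times> int \<Rightarrow> complex ^ 2 ^ 2" where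
  "opE q k =
     (let d = pi * \<i> * (of_int (snd k) * q k $ 1 + of_int (fst k) * q k $ 2)
      in vector [vector [2 * pi * \<i> * of_int (fst k) * q k $ 1, d],
                 vector [d, 2 * pi * \<i> * of_int (snd k) * q k $ 2]])"

text \<open>
  Rows and columns are indexed by grid points. The lists \<open>rs\<close> and \<open>cs\<close> enumerate \<open>O:K\<close> and \<open>K\<close> and
  identify these index sets with \<open>{0..<M1}\<close> and \<open>{0..<M2}\<close>; any enumerations are allowed.
\<close>

definition hankel ::
  "(int \<times> int) list \<Rightarrow> (int \<times> int) list \<Rightarrow> (int \<times> int \<Rightarrow> complex) \<Rightarrow> complex mat" where
  "hankel rs cs w = Matrix.mat (length rs) (length cs) (\<lambda>(i, j). w (rs ! i + cs ! j))"

definition hankel2 ::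
  "(int \<times> int) list \<Rightarrow> (int \<times> int) list \<Rightarrow> (int \<times> int \<Rightarrow> complex ^ 2) \<Rightarrow> complex mat" where
  "hankel2 rs cs w = hankel rs cs (\<lambda>k. w k $ 1) @\<^sub>r hankel rs cs (\<lambda>k. w k $ 2)"

definition hankel4 ::
  "(int \<times> int) list \<Rightarrow> (int \<times> int) list \<Rightarrow> (int \<times> int \<Rightarrow> complex ^ 2 ^ 2) \<Rightarrow> complex mat" where
  "hankel4 rs cs w =
     hankel rs cs (\<lambda>k. w k $ 1 $ 1) @\<^sub>r hankel rs cs (\<lambda>k. w k $ 1 $ 2) @\<^sub>r
     hankel rs cs (\<lambda>k. w k $ 2 $ 1) @\<^sub>r hankel rs cs (\<lambda>k. w k $ 2 $ 2)"

definition mat_rank :: "complex mat \<Rightarrow> nat" where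
  "mat_rank A = vec_space.rank (dim_row A) A"

definition unitary_mat :: "nat \<Rightarrow> complex mat \<Rightarrow> bool" where
  "unitary_mat n U \<longleftrightarrow>
     U \<in> carrier_mat n n \<and> U * mat_adjoint U = 1\<^sub>m n \<and> mat_adjoint U * U = 1\<^sub>m n"

definition full_svd :: "complex mat \<Rightarrow> complex mat \<Rightarrow> complex mat \<Rightarrow> complex mat \<Rightarrow> bool" where
  "full_svd A X S Y \<longleftrightarrow>
     unitary_mat (dim_row A) X \<and> unitary_mat (dim_col A) Y \<and>
     S \<in> carrier_mat (dim_row A) (dim_col A) \<and> diagonal_mat S \<and>
     (\<forall>i < min (dim_row A) (dim_col A). S $$ (i, i) \<in> \<real> \<and> 0 \<le> Re (S $$ (i, i))) \<and>
     (\<forall>i j. i \<le> j \<and> j < min (dim_row A) (dim_col A) \<longrightarrow> Re (S $$ (j, j)) \<le> Re (S $$ (i, i))) \<and>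
     A = X * S * mat_adjoint Y"

definition wrap :: "nat \<Rightarrow> int \<Rightarrow> int" where
  "wrap N j = (j + \<lfloor>real N / 2\<rfloor>) mod int N - \<lfloor>real N / 2\<rfloor>"

definition periodize :: "nat \<Rightarrow> (int \<times> int \<Rightarrow> complex) \<Rightarrow> int \<times> int \<Rightarrow> complex" where
  "periodize N w k = w (wrap N (fst k), wrap N (snd k))"

text \<open>The filters \<open>a\<close> are finitely supported, so this is a finite sum.\<close>

definition conv :: "nat \<Rightarrow> (int \<times> int \<Rightarrow> complex) \<Rightarrow> (int \<times> int \<Rightarrow> complex) \<Rightarrow> int \<times> int \<Rightarrow> complex" where
  "conv N a w k = (\<Sum>\<^sub>\<infinity>m\<in>UNIV. a (k - m) * periodize N w m)"

definition reflect :: "(int \<times> int \<Rightarrow> complex) \<Rightarrow> int \<times> int \<Rightarrow> complex" where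
  "reflect a k = a (- k)"

definition conj_filter :: "(int \<times> int \<Rightarrow> complex) \<Rightarrow> int \<times> int \<Rightarrow> complex" where
  "conj_filter a k = cnj (a k)"

definition analysis ::
  "nat \<Rightarrow> (nat \<Rightarrow> int \<times> int \<Rightarrow> complex) \<Rightarrow> (int \<times> int \<Rightarrow> complex) \<Rightarrow> nat \<Rightarrow> int \<times> int \<Rightarrow> complex" where
  "analysis N a w l = conv N (reflect (a l)) w"

text \<open>
  \<open>synthesis\<close> is the adjoint of \<open>analysis\<close> for the standard inner products on functions on
  \<open>grid N\<close>.
\<close>

definition synthesis ::
  "nat \<Rightarrow> nat \<Rightarrow> (nat \<Rightarrow> int \<times> int \<Rightarrow> complex) \<Rightarrow> (nat \<Rightarrow> int \<times> int \<Rightarrow> complex) \<Rightarrow> int \<times> int \<Rightarrow> complex" where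
  "synthesis N M a c k = (\<Sum>l<M. conv N (conj_filter (a l)) (c l) k)"

definition tight_frame :: "nat \<Rightarrow> nat \<Rightarrow> (nat \<Rightarrow> int \<times> int \<Rightarrow> complex) \<Rightarrow> bool" where
  "tight_frame N M a \<longleftrightarrow> (\<forall>w. \<forall>k\<in>grid N. synthesis N M a (analysis N a w) k = w k)"

text \<open>
  Column \<open>l\<close> of \<open>Y\<close> read as a filter supported on the set enumerated by \<open>cs\<close>: as \<open>cs\<close> is distinct,
  the value at \<open>cs ! j\<close> is \<open>Y $$ (j, l) / sqrt (length cs)\<close>, and the value off \<open>set cs\<close> is zero.
  Columns are numbered from \<open>0\<close>, so the columns \<open>r + 1, \<dots>, M\<close> of a numbering from \<open>1\<close> are \<open>l \<in> {r..<M}\<close>.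
\<close>

definition col_filter :: "(int \<times> int) list \<Rightarrow> complex mat \<Rightarrow> nat \<Rightarrow> int \<times> int \<Rightarrow> complex" where
  "col_filter cs Y l k =
     (\<Sum>j<length cs. if cs ! j = k then Y $$ (j, l) / complex_of_real (sqrt (real (length cs))) else 0)"

end

theory Submission
  imports Defs
begin

text \<open>
  Write \<open>A = X \<Sigma> Y\<^sup>*\<close> for either Hankel matrix. As \<open>Y\<close> is unitary, its rows are orthonormal, so
  the filters satisfy \<open>\<Sum>\<^sub>l cnj (a\<^sub>l m) a\<^sub>l n = \<delta>\<^sub>m\<^sub>n / M\<^sub>2\<close>; each of the \<open>M\<^sub>2\<close> shifts in \<open>K\<close> then
  contributes \<open>w / M\<^sub>2\<close> to \<open>W\<^sup>* W w\<close>. On \<open>O:K\<close> no wrap-around occurs, so the convolution with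
  the reflected filter is the matrix-vector product of the Hankel matrix with a column of \<open>Y\<close>, and
  this column of \<open>A Y = X \<Sigma>\<close> vanishes once its singular value does. The columns of \<open>X\<close> with
  nonzero singular value are independent and lie in the range of \<open>A\<close>, so there are at most
  rank \<open>A\<close> of them.
\<close>

section \<open>Periodic convolution and tight frames\<close>

lemma periodize_grid:
  assumes "k \<in> grid N"
  shows "periodize N w k = w k"
proof -
  have "wrap N j = j" if "- \<lfloor>real N / 2\<rfloor> \<le> j" "j \<le> \<lfloor>(real N - 1) / 2\<rfloor>" for j
  proof -
    \<comment> \<open>The two floors add up to at most \<open>N - 1/2\<close>. Hence
      \<open>j + \<lfloor>real N / 2\<rfloor>\<close> lies in \<open>{0..<N}\<close>, where
      reduction modulo \<open>N\<close> changes nothing.\<close>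
    have "real_of_int (\<lfloor>(real N - 1) / 2\<rfloor> + \<lfloor>real N / 2\<rfloor>) < real_of_int (int N)"
      using of_int_floor_le[of "(real N - 1) / 2"] of_int_floor_le[of "real N / 2"]
      by (simp add: field_simps)
    then have "\<lfloor>(real N - 1) / 2\<rfloor> + \<lfloor>real N / 2\<rfloor> < int N"
      by (simp only: of_int_less_iff)
    then show ?thesis
      using that by (simp add: wrap_def)
  qed
  then show ?thesis
    using assms by (cases k) (simp add: grid_def periodize_def)
qed

text \<open>Reduction modulo \<open>N\<close> commutes with shifts. This makes convolutions
  periodic, so the analysis coefficients can be evaluated off the grid.\<close>

lemma wrap_add: "wrap N (wrap N i + j) = wrap N (i + j)"
proof -
  have "wrap N i + j + \<lfloor>real N / 2\<rfloor> = (i + \<lfloor>real N / 2\<rfloor>) mod int N + j"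
    by (simp add: wrap_def)
  then show ?thesis
    unfolding wrap_def[of N "_ + j"] by (simp add: mod_simps ac_simps)
qed

text \<open>Only points \<open>m\<close> with \<open>k - m \<in> K\<close> contribute; substituting
  \<open>k - m\<close> for \<open>m\<close> moves the shift from the filter to the signal.\<close>

lemma conv_eq_sum:
  assumes "finite K" and "\<And>m. m \<notin> K \<Longrightarrow> a m = 0"
  shows "conv N a w k = (\<Sum>m\<in>K. a m * periodize N w (k - m))"
proof -
  have "conv N a w k = (\<Sum>\<^sub>\<infinity>m\<in>(\<lambda>m. k - m) ` K. a (k - m) * periodize N w m)"
    unfolding conv_def
  proof (rule infsum_cong_neutral)
    fix m assume "m \<in> UNIV - (\<lambda>m. k - m) ` K"
    then have "k - m \<notin> K"
      by (metis DiffD2 diff_diff_eq2 add_diff_cancel_left' image_eqI)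
    then show "a (k - m) * periodize N w m = 0"
      using assms(2) by simp
  qed auto
  also have "\<dots> = (\<Sum>m\<in>(\<lambda>m. k - m) ` K. a (k - m) * periodize N w m)"
    using assms(1) by simp
  also have "\<dots> = (\<Sum>m\<in>K. a m * periodize N w (k - m))"
    by (subst sum.reindex) (auto simp: inj_on_def)
  finally show ?thesis .
qed

text \<open>Reflection turns the shift \<open>k - m\<close> into \<open>k + m\<close>, which is the
  index pattern of a Hankel matrix.\<close>

lemma conv_reflect_eq_sum:
  assumes "finite K" and "\<And>m. m \<notin> K \<Longrightarrow> a m = 0"
  shows "conv N (reflect a) w k = (\<Sum>m\<in>K. a m * periodize N w (k + m))"
proof -
  have "conv N (reflect a) w k = (\<Sum>m\<in>uminus ` K. reflect a m * periodize N w (k - m))"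
  proof (rule conv_eq_sum)
    fix m assume "m \<notin> uminus ` K"
    then have "- m \<notin> K"
      by (metis image_eqI minus_minus)
    then show "reflect a m = 0"
      using assms(2) by (simp add: reflect_def)
  qed (use assms(1) in simp)
  also have "\<dots> = (\<Sum>m\<in>K. a m * periodize N w (k + m))"
    by (subst sum.reindex) (auto simp: inj_on_def reflect_def)
  finally show ?thesis .
qed

lemma tight_frameI:
  assumes K: "finite K" "K \<noteq> {}"
    and supp: "\<And>l m. l < M \<Longrightarrow> m \<notin> K \<Longrightarrow> a l m = 0"
    and orth: "\<And>m n. m \<in> K \<Longrightarrow> n \<in> K \<Longrightarrow>
      (\<Sum>l<M. cnj (a l m) * a l n) = (if m = n then 1 / of_nat (card K) else 0)"
  shows "tight_frame N M a"
  unfolding tight_frame_def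
proof (intro allI ballI)
  fix w k assume k: "k \<in> grid N"
  let ?w = "periodize N w"
  \<comment> \<open>Synthesis evaluates the coefficients at \<open>k - m\<close>, which may leave
    the grid. Their periodization is given by the same finite sum at every point.\<close>
  have per: "periodize N (analysis N a w l) k' = (\<Sum>n\<in>K. a l n * ?w (k' + n))" if "l < M" for l k'
    using supp[OF that] K(1)
    by (simp add: analysis_def periodize_def[of N "conv _ _ _"] conv_reflect_eq_sum)
      (simp add: periodize_def wrap_add)
  have "synthesis N M a (analysis N a w) k
      = (\<Sum>l<M. \<Sum>m\<in>K. cnj (a l m) * (\<Sum>n\<in>K. a l n * ?w (k - m + n)))"
    unfolding synthesis_def
  proof (rule sum.cong[OF refl])
    fix l assume "l \<in> {..<M}"
    then show "conv N (conj_filter (a l)) (analysis N a w l) k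
      = (\<Sum>m\<in>K. cnj (a l m) * (\<Sum>n\<in>K. a l n * ?w (k - m + n)))"
      using supp K(1) by (subst conv_eq_sum[where K = K]) (simp_all add: conj_filter_def per)
  qed
  also have "\<dots> = (\<Sum>l<M. \<Sum>m\<in>K. \<Sum>n\<in>K. cnj (a l m) * a l n * ?w (k - m + n))"
    by (simp add: sum_distrib_left mult.assoc)
  also have "\<dots> = (\<Sum>m\<in>K. \<Sum>n\<in>K. \<Sum>l<M. cnj (a l m) * a l n * ?w (k - m + n))"
    by (subst sum.swap, intro sum.cong refl, rule sum.swap)
  also have "\<dots> = (\<Sum>m\<in>K. \<Sum>n\<in>K. (\<Sum>l<M. cnj (a l m) * a l n) * ?w (k - m + n))"
    by (simp add: sum_distrib_right)
  \<comment> \<open>Orthogonality keeps only \<open>m = n\<close>, where the shifts by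
    \<open>- m\<close> and \<open>n\<close> cancel; \<open>card K\<close> equal terms
    remain.\<close>
  also have "\<dots> = (\<Sum>m\<in>K. \<Sum>n\<in>K. if m = n then ?w k / of_nat (card K) else 0)"
    by (intro sum.cong refl) (simp add: orth)
  also have "\<dots> = ?w k"
    using K by simp
  finally show "synthesis N M a (analysis N a w) k = w k"
    by (simp add: periodize_grid[OF k])
qed

section \<open>Rank and singular value decomposition\<close>

lemma (in vec_space) card_lin_indpt_le_rank:
  assumes A: "A \<in> carrier_mat n nc"
    and U: "U \<subseteq> carrier_vec n" "lin_indpt U"
    and range: "\<And>x. x \<in> U \<Longrightarrow> \<exists>y\<in>carrier_vec nc. A *\<^sub>v y = x"
  shows "card U \<le> rank A"
proof -
  let ?W = "span (set (cols A))"
  have cols: "set (cols A) \<subseteq> carrier_vec n"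
    using A cols_dim[of A] by simp
  have U_sub: "U \<subseteq> ?W"
    using col_space_eq[OF A] U(1) range A unfolding col_space_def by fastforce
  \<comment> \<open>The rank is the dimension of the column span, so independence is transferred
    from the ambient space to that span before dimensions are compared.\<close>
  have "LinearCombinations.module.lin_indpt class_ring (vs ?W) U"
    using span_li_not_depend(2)[OF U_sub span_is_submodule[OF cols]] U(2) by simp
  moreover have "vectorspace class_ring (vs ?W)"
    using span_is_subspace[OF cols] by (rule subspace_is_vs)
  moreover have "vectorspace.fin_dim class_ring (vs ?W)"
    using A by (rule fin_dim_span_cols)
  ultimately show ?thesis
    unfolding rank_def using U_sub by (intro vectorspace.li_le_dim(2)) auto
qed

text \<open>A nonzero determinant means full rank. Distinctness is recorded separately because a set
  of columns forgets repetitions, and the columns are counted later.\<close>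

lemma (in vec_space) distinct_lin_indpt_cols:
  assumes "A \<in> carrier_mat n n" and "det A \<noteq> 0"
  shows "distinct (cols A)" and "lin_indpt (set (cols A))"
proof -
  have rank: "rank A = n"
    using det_rank_iff[OF assms(1)] assms(2) by simp
  then show "distinct (cols A)"
    using non_distinct_low_rank[OF assms(1)] by fastforce
  then show "lin_indpt (set (cols A))"
    using full_rank_lin_indpt[OF assms(1) rank] by simp
qed

lemma mat_adjoint_carrier: "A \<in> carrier_mat n m \<Longrightarrow> mat_adjoint A \<in> carrier_mat m n"
  by (auto simp: mat_adjoint_def)

lemma mat_adjoint_index:
  "i < dim_col A \<Longrightarrow> j < dim_row A \<Longrightarrow> mat_adjoint A $$ (i, j) = conjugate (A $$ (j, i))"
  by (simp add: mat_adjoint_def mat_of_rows_index)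

text \<open>This is \<open>A * Y = X * S\<close> read column by column. If \<open>i\<close> is at
  least the number of rows, column \<open>i\<close> of \<open>S\<close> lies beyond the diagonal and
  is zero.\<close>

lemma full_svd_mult_col:
  assumes svd: "full_svd A X S Y" and i: "i < dim_col A"
  shows "A *\<^sub>v col Y i
    = (if i < dim_row A then S $$ (i, i) \<cdot>\<^sub>v col X i else 0\<^sub>v (dim_row A))"
proof -
  let ?n = "dim_row A" and ?m = "dim_col A"
  have X: "X \<in> carrier_mat ?n ?n" and S: "S \<in> carrier_mat ?n ?m" and Y: "Y \<in> carrier_mat ?m ?m"
    and diag: "diagonal_mat S" and A: "A = X * S * mat_adjoint Y"
    and YY: "mat_adjoint Y * Y = 1\<^sub>m ?m"
    using svd unfolding full_svd_def unitary_mat_def by blast+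
  have "A * Y = X * S * (mat_adjoint Y * Y)"
    by (subst A, rule assoc_mult_mat[OF mult_carrier_mat[OF X S] mat_adjoint_carrier[OF Y] Y])
  then have AY: "A * Y = X * S"
    using X S by (simp add: YY)
  have "A *\<^sub>v col Y i = col (A * Y) i"
    using Y i by (intro col_mult2[symmetric]) auto
  also have "\<dots> = X *\<^sub>v col S i"
    unfolding AY using X S i by (rule col_mult2)
  also have "\<dots> = (if i < ?n then S $$ (i, i) \<cdot>\<^sub>v col X i else 0\<^sub>v ?n)"
  proof (rule eq_vecI)
    fix j assume "j < dim_vec (if i < ?n then S $$ (i, i) \<cdot>\<^sub>v col X i else 0\<^sub>v ?n)"
    then have j: "j < ?n"
      using X by (auto split: if_splits)
    have "vec_index (X *\<^sub>v col S i) j = (\<Sum>h<?n. X $$ (j, h) * S $$ (h, i))"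
      using X S i j by (simp add: scalar_prod_def lessThan_atLeast0)
    also have "\<dots> = (\<Sum>h<?n. if h = i then X $$ (j, i) * S $$ (i, i) else 0)"
      using diag S i by (intro sum.cong) (auto simp: diagonal_mat_def)
    finally show "vec_index (X *\<^sub>v col S i) j
        = vec_index (if i < ?n then S $$ (i, i) \<cdot>\<^sub>v col X i else 0\<^sub>v ?n) j"
      using X j by simp
  qed (use X in auto)
  finally show ?thesis .
qed

text \<open>If the singular value with index \<open>l\<close> were nonzero, then so would be all
  those before it. This would give \<open>l + 1\<close> independent columns of \<open>X\<close> in
  the range of \<open>A\<close>, although the rank is at most \<open>l\<close>.\<close>

lemma full_svd_mult_col_eq_0:
  assumes svd: "full_svd A X S Y" and l: "mat_rank A \<le> l" "l < dim_col A"
  shows "A *\<^sub>v col Y l = 0\<^sub>v (dim_row A)"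
\<comment> \<open>The negation covers both harmless situations: no diagonal entry with index
  \<open>l\<close>, or a vanishing one. The other case is contradictory.\<close>
proof (cases "l < dim_row A \<and> S $$ (l, l) \<noteq> 0")
  case False
  have "X \<in> carrier_mat (dim_row A) (dim_row A)"
    using svd unfolding full_svd_def unitary_mat_def by blast
  then have "0 \<cdot>\<^sub>v col X l = 0\<^sub>v (dim_row A)"
    by auto
  then show ?thesis
    using False full_svd_mult_col[OF svd l(2)] by auto
next
  case True
  let ?n = "dim_row A" and ?m = "dim_col A"
  interpret vec_space "TYPE(complex)" ?n .
  have X: "X \<in> carrier_mat ?n ?n" and Y: "Y \<in> carrier_mat ?m ?m"
    and XX: "mat_adjoint X * X = 1\<^sub>m ?n"
    and real: "\<forall>i < min ?n ?m. S $$ (i, i) \<in> \<real> \<and> 0 \<le> Re (S $$ (i, i))"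
    and mono: "\<forall>i j. i \<le> j \<and> j < min ?n ?m \<longrightarrow> Re (S $$ (j, j)) \<le> Re (S $$ (i, i))"
    using svd unfolding full_svd_def unitary_mat_def by - (elim conjE; assumption)+
  have "det (mat_adjoint X) * det X = 1"
    using det_mult[OF mat_adjoint_carrier[OF X] X] by (simp add: XX)
  then have det: "det X \<noteq> 0"
    by auto
  have "Re (S $$ (l, l)) \<noteq> 0"
    using True real l(2) by (auto simp: complex_is_Real_iff complex_eq_iff)
  then have pos: "Re (S $$ (l, l)) > 0"
    using real True l(2) by fastforce
  \<comment> \<open>The nonincreasing order propagates positivity from \<open>l\<close> to all
    smaller indices.\<close>
  have nz: "S $$ (i, i) \<noteq> 0" if "i \<le> l" for i
    using mono[rule_format, of i l] that pos True l(2) by auto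
  define U where "U = col X ` {..l}"
  have U_sub: "U \<subseteq> set (cols X)"
    using True X by (auto simp: U_def cols_def)
  have "inj_on (col X) {..<?n}"
    using distinct_lin_indpt_cols(1)[OF X det] X
    by (auto simp: cols_def distinct_map lessThan_atLeast0)
  then have "inj_on (col X) {..l}"
    by (rule inj_on_subset) (use True in auto)
  then have "Suc l = card U"
    by (simp add: U_def card_image)
  also have "\<dots> \<le> rank A"
  proof (rule card_lin_indpt_le_rank)
    show "A \<in> carrier_mat ?n ?m"
      by simp
    show "U \<subseteq> carrier_vec ?n"
      using X by (auto simp: U_def intro!: carrier_vecI)
    show "lin_indpt U"
      using subset_li_is_li[OF distinct_lin_indpt_cols(2)[OF X det] U_sub] .
    fix x assume "x \<in> U"
    then obtain i where i: "i \<le> l" and x: "x = col X i"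
      by (auto simp: U_def)
    \<comment> \<open>Since \<open>A\<close> sends column \<open>i\<close> of \<open>Y\<close> to a
      nonzero multiple of column \<open>i\<close> of \<open>X\<close>, rescaling gives an explicit
      preimage.\<close>
    have "A *\<^sub>v (inverse (S $$ (i, i)) \<cdot>\<^sub>v col Y i) = inverse (S $$ (i, i)) \<cdot>\<^sub>v (A *\<^sub>v col Y i)"
      using Y by (intro mult_mat_vec[of _ ?n ?m] carrier_vecI) auto
    also have "\<dots> = x"
      using nz[OF i] i True l(2) full_svd_mult_col[OF svd, of i] by (simp add: x smult_smult_assoc)
    finally show "\<exists>y\<in>carrier_vec ?m. A *\<^sub>v y = x"
      using Y by (intro bexI[of _ "inverse (S $$ (i, i)) \<cdot>\<^sub>v col Y i"] carrier_vecI) auto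
  qed
  also have "\<dots> \<le> l"
    using l(1) by (simp add: mat_rank_def)
  finally show ?thesis
    by simp
qed

section \<open>Column filters and stacked Hankel matrices\<close>

lemma append_rows_mult_eq_0D:
  assumes A: "A \<in> carrier_mat n1 m" and B: "B \<in> carrier_mat n2 m" and v: "v \<in> carrier_vec m"
    and 0: "(A @\<^sub>r B) *\<^sub>v v = 0\<^sub>v (n1 + n2)"
  shows "A *\<^sub>v v = 0\<^sub>v n1" and "B *\<^sub>v v = 0\<^sub>v n2"
proof -
  have "(A *\<^sub>v v) @\<^sub>v (B *\<^sub>v v) = 0\<^sub>v n1 @\<^sub>v 0\<^sub>v n2"
    using 0 mat_mult_append[OF A B v] by (auto intro!: eq_vecI)
  then show "A *\<^sub>v v = 0\<^sub>v n1" "B *\<^sub>v v = 0\<^sub>v n2"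
    using append_vec_eq[OF mult_mat_vec_carrier[OF A v] zero_carrier_vec] by blast+
qed

lemma col_filter_nth:
  assumes "distinct cs" and "j < length cs"
  shows "col_filter cs Y l (cs ! j) = Y $$ (j, l) / complex_of_real (sqrt (real (length cs)))"
proof -
  have "col_filter cs Y l (cs ! j)
      = (\<Sum>i<length cs. if i = j then Y $$ (i, l) / complex_of_real (sqrt (real (length cs))) else 0)"
    unfolding col_filter_def using assms by (intro sum.cong refl) (simp add: nth_eq_iff_index_eq)
  then show ?thesis
    using assms(2) by simp
qed

lemma col_filter_eq_0: "k \<notin> set cs \<Longrightarrow> col_filter cs Y l k = 0"
  by (auto simp: col_filter_def intro!: sum.neutral)

text \<open>The required relation sums over the filter index, so it is orthonormality of the rows of
  \<open>Y\<close>, that is, \<open>Y * mat_adjoint Y = 1\<^sub>m ?M\<close>; the normalization of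
  the filters supplies the factor \<open>1 / M\<close>.\<close>

lemma tight_frame_col_filter:
  assumes Y: "unitary_mat (length cs) Y" and cs: "distinct cs" "cs \<noteq> []"
    and a: "\<And>l. l < length cs \<Longrightarrow> a l = col_filter cs Y l"
  shows "tight_frame N (length cs) a"
proof (rule tight_frameI)
  let ?M = "length cs"
  have Y_carrier: "Y \<in> carrier_mat ?M ?M" and YY: "Y * mat_adjoint Y = 1\<^sub>m ?M"
    using Y by (auto simp: unitary_mat_def)
  fix m n assume "m \<in> set cs" "n \<in> set cs"
  then obtain i j where i: "i < ?M" "m = cs ! i" and j: "j < ?M" "n = cs ! j"
    by (metis in_set_conv_nth)
  have s: "complex_of_real (sqrt (real ?M)) * complex_of_real (sqrt (real ?M)) = of_nat ?M"
    by (simp flip: of_real_mult)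
  have "(\<Sum>l<?M. cnj (a l m) * a l n) = (\<Sum>l<?M. Y $$ (j, l) * cnj (Y $$ (i, l))) / of_nat ?M"
    unfolding sum_divide_distrib using i j cs
    by (intro sum.cong refl) (simp add: a col_filter_nth s)
  also have "(\<Sum>l<?M. Y $$ (j, l) * cnj (Y $$ (i, l))) = (Y * mat_adjoint Y) $$ (j, i)"
    using Y_carrier mat_adjoint_carrier[OF Y_carrier] i j
    by (simp add: scalar_prod_def mat_adjoint_index lessThan_atLeast0)
  also have "\<dots> = (if m = n then 1 else 0)"
    using i j cs by (auto simp: YY nth_eq_iff_index_eq)
  finally show "(\<Sum>l<?M. cnj (a l m) * a l n) = (if m = n then 1 / of_nat (card (set cs)) else 0)"
    using cs by (simp add: distinct_card)
qed (use cs a col_filter_eq_0 in auto)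

text \<open>Up to the factor \<open>1 / ?s\<close>, the coefficient at \<open>rs ! i\<close> is
  entry \<open>i\<close> of the Hankel matrix applied to column \<open>l\<close> of
  \<open>Y\<close>.\<close>

lemma conv_col_filter_eq_0:
  assumes cs: "distinct cs" "set cs = K" and rs: "set rs = grid_colon (grid N) K"
    and Y: "Y \<in> carrier_mat (length cs) m" "l < m"
    and null: "hankel rs cs w *\<^sub>v col Y l = 0\<^sub>v (length rs)"
    and k: "k \<in> grid_colon (grid N) K"
  shows "conv N (reflect (col_filter cs Y l)) w k = 0"
proof -
  let ?s = "complex_of_real (sqrt (real (length cs)))"
  obtain i where i: "i < length rs" "k = rs ! i"
    using k rs by (metis in_set_conv_nth)
  have "conv N (reflect (col_filter cs Y l)) w k
      = (\<Sum>m\<in>set cs. col_filter cs Y l m * periodize N w (k + m))"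
    by (rule conv_reflect_eq_sum) (auto simp: col_filter_eq_0)
  \<comment> \<open>By the definition of \<open>grid_colon\<close>, every \<open>k + m\<close> stays
    in the grid, so the periodic extension is not seen.\<close>
  also have "\<dots> = (\<Sum>m\<in>set cs. col_filter cs Y l m * w (k + m))"
    using k cs(2) by (intro sum.cong refl) (simp add: grid_colon_def periodize_grid)
  also have "\<dots> = (\<Sum>j<length cs. col_filter cs Y l (cs ! j) * w (k + cs ! j))"
    using cs(1) by (intro sum.reindex_bij_betw[symmetric] bij_betw_nth) auto
  also have "\<dots> = vec_index (hankel rs cs w *\<^sub>v col Y l) i / ?s"
    using i Y cs(1)
    by (simp add: hankel_def scalar_prod_def col_filter_nth lessThan_atLeast0 sum_divide_distrib mult.commute)
  also have "\<dots> = 0"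
    using i by (simp add: null)
  finally show ?thesis .
qed

lemma hankel_carrier: "hankel rs cs w \<in> carrier_mat (length rs) (length cs)"
  by (simp add: hankel_def)

lemma hankel2_carrier: "hankel2 rs cs w \<in> carrier_mat (length rs + length rs) (length cs)"
  unfolding hankel2_def by (intro carrier_append_rows hankel_carrier)

lemma hankel4_carrier:
  "hankel4 rs cs w \<in>
    carrier_mat (length rs + (length rs + (length rs + length rs))) (length cs)"
  unfolding hankel4_def by (intro carrier_append_rows hankel_carrier)

lemma hankel2_mult_eq_0D:
  assumes "y \<in> carrier_vec (length cs)"
    and "hankel2 rs cs w *\<^sub>v y = 0\<^sub>v (dim_row (hankel2 rs cs w))"
  shows "hankel rs cs (\<lambda>k. w k $ i) *\<^sub>v y = 0\<^sub>v (length rs)"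
proof -
  note H = hankel_carrier[of rs cs]
  have "(hankel rs cs (\<lambda>k. w k $ 1) @\<^sub>r hankel rs cs (\<lambda>k. w k $ 2)) *\<^sub>v y
      = 0\<^sub>v (length rs + length rs)"
    using assms(2) hankel2_carrier[of rs cs w] by (simp add: hankel2_def)
  from append_rows_mult_eq_0D[OF H H assms(1) this] exhaust_2[of i] show ?thesis
    by auto
qed

lemma hankel4_mult_eq_0D:
  assumes "y \<in> carrier_vec (length cs)"
    and "hankel4 rs cs w *\<^sub>v y = 0\<^sub>v (dim_row (hankel4 rs cs w))"
  shows "hankel rs cs (\<lambda>k. w k $ i $ j) *\<^sub>v y = 0\<^sub>v (length rs)"
proof -
  let ?H = "\<lambda>i j. hankel rs cs (\<lambda>k. w k $ i $ j)"
  note H = hankel_carrier[of rs cs]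
  have "(?H 1 1 @\<^sub>r ?H 1 2 @\<^sub>r ?H 2 1 @\<^sub>r ?H 2 2) *\<^sub>v y
      = 0\<^sub>v (length rs + (length rs + (length rs + length rs)))"
    using assms(2) hankel4_carrier[of rs cs w] by (simp add: hankel4_def)
  \<comment> \<open>The stacking nests to the right, so each application peels off the top block and
    passes on the rest.\<close>
  note 1 = append_rows_mult_eq_0D[OF H _ assms(1) this]
  note 2 = append_rows_mult_eq_0D[OF H _ assms(1) 1(2)]
  note 3 = append_rows_mult_eq_0D[OF H H assms(1) 2(2)]
  have "?H 1 1 *\<^sub>v y = 0\<^sub>v (length rs)" "?H 1 2 *\<^sub>v y = 0\<^sub>v (length rs)"
    "?H 2 1 *\<^sub>v y = 0\<^sub>v (length rs)" "?H 2 2 *\<^sub>v y = 0\<^sub>v (length rs)"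
    by (intro 1 2 3 carrier_append_rows H)+
  then show ?thesis
    using exhaust_2[of i] exhaust_2[of j] by auto
qed

theorem theorem3p1:
  fixes u :: "real ^ 2 \<Rightarrow> complex" and J :: nat
    and \<Omega> :: "nat \<Rightarrow> (real ^ 2) set" and \<alpha> :: "nat \<Rightarrow> complex ^ 2" and \<beta> :: "nat \<Rightarrow> complex"
    and \<Lambda> :: "(int \<times> int) set" and a :: "int \<times> int \<Rightarrow> complex"
    and p :: "real ^ 2 \<Rightarrow> complex ^ 2"
    and N K1 K2 M1 M2 r1 r2 :: nat and m1 m2 :: int
    and K :: "(int \<times> int) set" and rs cs :: "(int \<times> int) list"
    and v :: "int \<times> int \<Rightarrow> complex" and q g :: "int \<times> int \<Rightarrow> complex ^ 2"
    and e :: "int \<times> int \<Rightarrow> complex ^ 2 ^ 2"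
    and X1 S1 Y1 X2 S2 Y2 :: "complex mat"
    and a1 a2 :: "nat \<Rightarrow> int \<times> int \<Rightarrow> complex"
  assumes u: "minimal_pw_linear_rep u J \<Omega> \<alpha> \<beta>"
    and p: "associated_field u (\<Union>j\<in>{1..J}. frontier (\<Omega> j)) \<Lambda> a p"
    and N: "N \<ge> 1"
    and v: "\<And>k. k \<in> grid N \<Longrightarrow> v k = fourier u (pt k)"
    and q: "\<And>k i. k \<in> grid N \<Longrightarrow> q k $ i = fourier (\<lambda>x. p x $ i) (pt k)"
    and g: "\<And>k. k \<in> grid N \<Longrightarrow> g k = opD v k - q k"
    and e: "\<And>k. k \<in> grid N \<Longrightarrow> e k = opE q k"
    and K: "K1 \<ge> 1" "K2 \<ge> 1" "K = {m1..<m1 + int K1} \<times> {m2..<m2 + int K2}" "K \<subseteq> grid N"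
    and M1: "M1 = card (grid_colon (grid N) K)"
    and M2: "M2 = card K"
    and rs: "distinct rs" "set rs = grid_colon (grid N) K"
    and cs: "distinct cs" "set cs = K"
    and r1: "mat_rank (hankel2 rs cs g) = r1" "r1 < min (2 * M1) M2"
    and r2: "mat_rank (hankel4 rs cs e) = r2" "r2 < min (4 * M1) M2"
    and svd1: "full_svd (hankel2 rs cs g) X1 S1 Y1"
    and svd2: "full_svd (hankel4 rs cs e) X2 S2 Y2"
    and a1: "\<And>l. l < M2 \<Longrightarrow> a1 l = col_filter cs Y1 l"
    and a2: "\<And>l. l < M2 \<Longrightarrow> a2 l = col_filter cs Y2 l"
  shows
    "(\<forall>i. \<forall>k\<in>grid N.
        synthesis N M2 a1 (analysis N a1 (\<lambda>k. g k $ i)) k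
          = (\<Sum>l<M2. conv N (conj_filter (a1 l)) (conv N (reflect (a1 l)) (\<lambda>k. g k $ i)) k)
        \<and> (\<Sum>l<M2. conv N (conj_filter (a1 l)) (conv N (reflect (a1 l)) (\<lambda>k. g k $ i)) k)
          = g k $ i)
   \<and> (\<forall>i j. \<forall>k\<in>grid N.
        synthesis N M2 a2 (analysis N a2 (\<lambda>k. e k $ i $ j)) k
          = (\<Sum>l<M2. conv N (conj_filter (a2 l)) (conv N (reflect (a2 l)) (\<lambda>k. e k $ i $ j)) k)
        \<and> (\<Sum>l<M2. conv N (conj_filter (a2 l)) (conv N (reflect (a2 l)) (\<lambda>k. e k $ i $ j)) k)
          = e k $ i $ j)
   \<and> (\<forall>k\<in>grid_colon (grid N) K. \<forall>l\<in>{r1..<M2}. \<forall>i.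
        conv N (reflect (a1 l)) (\<lambda>k. g k $ i) k = 0)
   \<and> (\<forall>k\<in>grid_colon (grid N) K. \<forall>l\<in>{r2..<M2}. \<forall>i j.
        conv N (reflect (a2 l)) (\<lambda>k. e k $ i $ j) k = 0)
   \<and> tight_frame N M2 a1 \<and> tight_frame N M2 a2"
proof -
  have M2_cs: "length cs = M2"
    using cs M2 distinct_card by force
  \<comment> \<open>The corner of the rectangle lies in \<open>K\<close>, so the normalization by
    \<open>card K\<close> does not divide by zero.\<close>
  have cs_ne: "cs \<noteq> []"
  proof -
    have "(m1, m2) \<in> K"
      using K(1-3) by simp
    then show ?thesis
      using cs(2) by auto
  qed
  have dim_col: "dim_col (hankel2 rs cs g) = M2" "dim_col (hankel4 rs cs e) = M2"
    using hankel2_carrier[of rs cs g] hankel4_carrier[of rs cs e] by (auto simp: M2_cs)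
  have Y: "unitary_mat M2 Y1" "unitary_mat M2 Y2"
    using svd1 svd2 unfolding full_svd_def dim_col by blast+
  then have Y_carrier: "Y1 \<in> carrier_mat M2 M2" "Y2 \<in> carrier_mat M2 M2"
    by (auto simp: unitary_mat_def)
  have frame: "tight_frame N M2 a1" "tight_frame N M2 a2"
    using tight_frame_col_filter[of cs _ _ N] cs cs_ne Y a1 a2 by (auto simp: M2_cs)
  \<comment> \<open>The frame identity holds for every scalar signal, hence can be applied to each
    component separately.\<close>
  have rec: "(\<Sum>l<M2. conv N (conj_filter (b l)) (conv N (reflect (b l)) w) k) = w k"
    if "tight_frame N M2 b" "k \<in> grid N" for b w k
    using that by (auto simp: tight_frame_def synthesis_def analysis_def)
  have "conv N (reflect (a1 l)) (\<lambda>k. g k $ i) k = 0"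
    if k: "k \<in> grid_colon (grid N) K" and l: "l \<in> {r1..<M2}" for k l i
  proof -
    \<comment> \<open>With columns numbered from 0, the first \<open>r1\<close> columns have indices
      below \<open>r1\<close>, so index \<open>r1\<close> itself is already in the kernel.\<close>
    have "hankel2 rs cs g *\<^sub>v col Y1 l = 0\<^sub>v (dim_row (hankel2 rs cs g))"
      using svd1 by (rule full_svd_mult_col_eq_0) (use r1(1) l dim_col in auto)
    then have "hankel rs cs (\<lambda>k. g k $ i) *\<^sub>v col Y1 l = 0\<^sub>v (length rs)"
      by (intro hankel2_mult_eq_0D carrier_vecI) (use Y_carrier M2_cs in auto)
    then show ?thesis
      using conv_col_filter_eq_0[OF cs rs(2) _ _ _ k] Y_carrier l a1 by (auto simp: M2_cs)
  qed
  moreover have "conv N (reflect (a2 l)) (\<lambda>k. e k $ i $ j) k = 0"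
    if k: "k \<in> grid_colon (grid N) K" and l: "l \<in> {r2..<M2}" for k l i j
  proof -
    have "hankel4 rs cs e *\<^sub>v col Y2 l = 0\<^sub>v (dim_row (hankel4 rs cs e))"
      using svd2 by (rule full_svd_mult_col_eq_0) (use r2(1) l dim_col in auto)
    then have "hankel rs cs (\<lambda>k. e k $ i $ j) *\<^sub>v col Y2 l = 0\<^sub>v (length rs)"
      by (intro hankel4_mult_eq_0D carrier_vecI) (use Y_carrier M2_cs in auto)
    then show ?thesis
      using conv_col_filter_eq_0[OF cs rs(2) _ _ _ k] Y_carrier l a2 by (auto simp: M2_cs)
  qed
  ultimately show ?thesis
    using frame by (simp add: rec synthesis_def analysis_def)
qed

end
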